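(* Let $\mathcal{X}\subset\mathbb{R}^n$ be a nonempty compact set, let $\mathcal{M}=\{\int\mathbf{x}\,dP(\mathbf{x}):\ P\text{ a Borel probability measure on }\mathbb{R}^n\text{ with }\int_{\mathcal{X}}dP=1\}$, and fix a normal vector $\boldsymbol{\omega}\in\mathbb{R}^n$, $\boldsymbol{\omega}\ne 0$. For $\nu\in\mathbb{R}$ let $\mathcal{H}(\nu)=\{\boldsymbol{\rho}\in\mathbb{R}^n:\ \boldsymbol{\omega}^\top\boldsymbol{\rho}\le\nu\}$. Then the tightest half-space $\mathcal{H}(\nu)$ including $\mathcal{M}$ (or equivalently, including $\mathcal{X}$) is obtained for $\nu=\nu^*$, where $$\nu^*=\max_P\int\boldsymbol{\omega}^\top\mathbf{x}\,dP(\mathbf{x})\quad\text{s.t.}\quad\int_{\mathcal{X}}dP(\mathbf{x})=1,$$ the maximum being over Borel probability measures $P$ on $\mathbb{R}^n$.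
   Context: "Tightest" means: $\nu^*$ is the smallest $\nu\in\mathbb{R}$ such that $\mathcal{M}\subseteq\mathcal{H}(\nu)$; "or equivalently" means that it is also the smallest $\nu$ such that $\mathcal{X}\subseteq\mathcal{H}(\nu)$. *)

theory Defs
  imports "HOL-Probability.Probability"
begin

definition prob_measures_on :: "(real ^ 'n) set \<Rightarrow> (real ^ 'n) measure set" where
  "prob_measures_on X =
     {P. prob_space P \<and> sets P = sets borel \<and> (LINT x:X|P. (1::real)) = 1}"

definition mean_set :: "(real ^ 'n) set \<Rightarrow> (real ^ 'n) set" where
  "mean_set X = {(LINT x|P. x) | P. P \<in> prob_measures_on X}"

definition half_space :: "real ^ 'n \<Rightarrow> real \<Rightarrow> (real ^ 'n) set" where
  "half_space \<omega> \<nu> = {\<rho>. \<omega> \<bullet> \<rho> \<le> \<nu>}"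

text \<open>Attained maxima and minima of arbitrary (possibly infinite) sets of reals;
  the library's \<^const>\<open>Max\<close> and \<^const>\<open>Min\<close> are meant for finite sets only.\<close>

definition is_maximum :: "real set \<Rightarrow> real \<Rightarrow> bool" where
  "is_maximum A m \<longleftrightarrow> m \<in> A \<and> (\<forall>a\<in>A. a \<le> m)"

definition is_minimum :: "real set \<Rightarrow> real \<Rightarrow> bool" where
  "is_minimum A m \<longleftrightarrow> m \<in> A \<and> (\<forall>a\<in>A. m \<le> a)"

text \<open>The Bochner integral of a non-integrable function is 0 by convention. The following
  shows that this convention never applies to the means considered here.\<close>

lemma integrable_prob_measures_on:
  fixes X :: "(real ^ 'n) set"
  assumes "compact X" and P: "P \<in> prob_measures_on X"
  shows "integrable P (\<lambda>x. x)" and "integrable P (\<lambda>x. \<omega> \<bullet> x)"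
proof -
  interpret prob_space P using P by (simp add: prob_measures_on_def)
  have sP: "sets P = sets borel" using P by (simp add: prob_measures_on_def)
  have X: "X \<in> sets P" using \<open>compact X\<close> sP by (simp add: borel_compact)
  have "X \<inter> space P = X" using sets.sets_into_space[OF X] by blast
  then have "measure P X = 1"
    using P X by (simp add: prob_measures_on_def set_lebesgue_integral_def)
  then have ae: "AE x in P. x \<in> X" using X by (simp add: prob_eq_1)
  obtain B where B: "\<And>x. x \<in> X \<Longrightarrow> norm x \<le> B"
    using compact_imp_bounded[OF \<open>compact X\<close>] unfolding bounded_iff by blast
  have "AE x in P. norm x \<le> B" using ae B by auto
  moreover have "(\<lambda>x. x) \<in> borel_measurable P"
    using sP by (metis measurable_cong_sets measurable_ident_sets)
  ultimately show *: "integrable P (\<lambda>x. x)"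
    by (intro integrable_const_bound) auto
  show "integrable P (\<lambda>x. \<omega> \<bullet> x)"
    by (rule integrable_inner_right) (use * in simp)
qed

end

theory Submission
  imports Defs
begin

text \<open>A linear functional attains its maximum over \<open>X\<close> at some \<open>x0 \<in> X\<close>. The mean of the
  functional under a measure carried by \<open>X\<close> cannot exceed this value, and the Dirac measure
  at \<open>x0\<close> attains it.\<close>

lemma return_in_prob_measures_on:
  fixes X :: "(real ^ 'n) set"
  assumes "X \<in> sets borel" and "x \<in> X"
  shows "return borel x \<in> prob_measures_on X"
proof -
  have "(LINT y:X|return borel x. (1::real)) = 1"
    using assms unfolding set_lebesgue_integral_def by (subst integral_return) auto
  then show ?thesis
    by (simp add: prob_measures_on_def prob_space_return)
qed

text \<open>Turns the integral constraint into an almost sure statement, so that bounds valid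
  pointwise on \<open>X\<close> can be integrated against \<open>P\<close>.\<close>

lemma AE_prob_measures_on:
  fixes X :: "(real ^ 'n) set"
  assumes "X \<in> sets borel" and P: "P \<in> prob_measures_on X"
  shows "AE x in P. x \<in> X"
proof -
  interpret prob_space P using P by (simp add: prob_measures_on_def)
  have X: "X \<in> sets P" using assms by (simp add: prob_measures_on_def)
  \<comment> \<open>The set integral of 1 evaluates to the measure of
    \<open>X \<inter> space P\<close>.\<close>
  then have "X \<inter> space P = X" using sets.sets_into_space by blast
  then have "measure P X = 1"
    using P X by (simp add: prob_measures_on_def set_lebesgue_integral_def)
  then show ?thesis using X by (simp add: prob_eq_1)
qed

theorem theorem5:
  fixes X :: "(real ^ 'n) set" and \<omega> :: "real ^ 'n"
  assumes "compact X" and "X \<noteq> {}" and "\<omega> \<noteq> 0"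
  shows "\<exists>\<nu>.
      is_maximum {(LINT x|P. \<omega> \<bullet> x) | P. P \<in> prob_measures_on X} \<nu> \<and>
      is_minimum {\<mu>. mean_set X \<subseteq> half_space \<omega> \<mu>} \<nu> \<and>
      is_minimum {\<mu>. X \<subseteq> half_space \<omega> \<mu>} \<nu>"
proof -
  have borel: "X \<in> sets borel" using \<open>compact X\<close> by (rule borel_compact)
  have "continuous_on X (\<lambda>x. \<omega> \<bullet> x)" by (intro continuous_intros)
  then obtain x0 where x0: "x0 \<in> X" and max: "\<And>x. x \<in> X \<Longrightarrow> \<omega> \<bullet> x \<le> \<omega> \<bullet> x0"
    using continuous_attains_sup[OF \<open>compact X\<close> \<open>X \<noteq> {}\<close>] by blast
  have bound: "(LINT x|P. \<omega> \<bullet> x) \<le> \<omega> \<bullet> x0" if P: "P \<in> prob_measures_on X" for P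
  proof -
    interpret prob_space P using P by (simp add: prob_measures_on_def)
    have "AE x in P. \<omega> \<bullet> x \<le> \<omega> \<bullet> x0"
      using AE_prob_measures_on[OF borel P] max by auto
    \<comment> \<open>\<open>P\<close> has total mass 1, so an almost sure upper bound by a constant
      passes to the integral of an integrable function.\<close>
    then show ?thesis
      by (intro integral_le_const integrable_prob_measures_on[OF \<open>compact X\<close> P])
  qed
  \<comment> \<open>Links the points of \<open>mean_set X\<close> to the values being maximised:
    integrability lets the inner product move inside the Bochner integral.\<close>
  have inner_mean: "\<omega> \<bullet> (LINT x|P. x) = (LINT x|P. \<omega> \<bullet> x)" if "P \<in> prob_measures_on X" for P
    using integrable_prob_measures_on(1)[OF \<open>compact X\<close> that] by simp
  have dirac: "return borel x0 \<in> prob_measures_on X"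
    using borel x0 by (rule return_in_prob_measures_on)
  have dirac_mean: "(LINT x|return borel x0. \<omega> \<bullet> x) = \<omega> \<bullet> x0"
    by (rule integral_return) auto
  \<comment> \<open>The single witness \<open>\<omega> \<bullet> x0\<close> serves all three claims,
    so both notions of tightest agree.\<close>
  have "is_maximum {(LINT x|P. \<omega> \<bullet> x) | P. P \<in> prob_measures_on X} (\<omega> \<bullet> x0)"
    using bound dirac dirac_mean[symmetric] unfolding is_maximum_def by blast
  moreover have "is_minimum {\<mu>. mean_set X \<subseteq> half_space \<omega> \<mu>} (\<omega> \<bullet> x0)"
  proof -
    have "mean_set X \<subseteq> half_space \<omega> (\<omega> \<bullet> x0)"
      using bound inner_mean by (auto simp: mean_set_def half_space_def)
    \<comment> \<open>Minimality is tested at the mean of the Dirac measure, whose inner product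
      with \<open>\<omega>\<close> is \<open>\<omega> \<bullet> x0\<close>.\<close>
    moreover have "\<omega> \<bullet> x0 \<le> \<mu>" if "mean_set X \<subseteq> half_space \<omega> \<mu>" for \<mu>
    proof -
      have "(LINT x|return borel x0. x) \<in> mean_set X"
        using dirac unfolding mean_set_def by blast
      then show ?thesis
        using that inner_mean[OF dirac] dirac_mean by (auto simp: half_space_def)
    qed
    ultimately show ?thesis by (simp add: is_minimum_def)
  qed
  \<comment> \<open>Here \<open>x0\<close> itself is the point of \<open>X\<close> that forces the
    lower bound on \<open>\<mu>\<close>.\<close>
  moreover have "is_minimum {\<mu>. X \<subseteq> half_space \<omega> \<mu>} (\<omega> \<bullet> x0)"
    using max x0 by (auto simp: is_minimum_def half_space_def)
  ultimately show ?thesis by blast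
qed

end
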